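(* Let $R\ge1$ be an integer, $k\ge2$ an even integer, and $G=(V,E)$ a ring graph with $n=(2R+1)k$ vertices. Then every state $|\psi\rangle$ prepared by a $\mathbf Z_2$-symmetric range-$R$ quantum circuit satisfies, for all choices of signs $(\sigma_e)_{e\in E}\in\{-1,1\}^E$, $$\langle\psi|\sum_{e=\{e_0,e_1\}\in E}\left(1+\sigma_eZ_{e_0}Z_{e_1}\right)|\psi\rangle\ \ge\ \frac{n}{2R+1}.$$ In particular, for the MaxCut Hamiltonian $H_{\mathrm{MaxCut}}=\sum_{0\le i<n}\frac{1-Z_iZ_{i+1}}{2}$ of the ring graph (indices mod $n$), $$\langle\psi|H_{\mathrm{MaxCut}}|\psi\rangle\le n-\frac{n}{2(2R+1)}.$$
   Context: Qubits are labelled by the vertices of $G$. A circuit (unitary) $U$ has range $R$ with respect to $G$ if for every vertex $v$ and every single-qubit observable $\mathcal O_v$ supported on $v$, $U^\dagger\mathcal O_vU$ is supported on the set $B_G(v,R)$ of vertices at distance at most $R$ from $v$. A state $|\phi\rangle$ on $n$ qubits is $\mathbf Z_2$-symmetric if $X^{\otimes n}|\phi\rangle=|\phi\rangle$; a unitary $U$ is $\mathbf Z_2$-symmetric if $X^{\otimes n}UX^{\otimes n}=U$. A state is prepared by a $\mathbf Z_2$-symmetric range-$R$ circuit if it equals $U|\phi\rangle$ with $U$ a $\mathbf Z_2$-symmetric range-$R$ circuit and $|\phi\rangle$ a $\mathbf Z_2$-symmetric product state. *)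

theory Defs
  imports "HOL-Analysis.Analysis" "HOL-Library.Complex_Order" "HOL-Library.Extended_Nat"
begin

text \<open>
  Qubits are the elements of a finite type \<open>'v\<close>. The computational basis is indexed by
  bit assignments \<open>'v \<Rightarrow> bool\<close>, with \<open>False\<close> for \<open>|0>\<close> and \<open>True\<close> for \<open>|1>\<close>.
  In an operator \<open>A\<close>, the entry \<open>A $ x $ y\<close> is \<open><x|A|y>\<close>.
\<close>

type_synonym 'v qstate = "complex ^ ('v \<Rightarrow> bool)"
type_synonym 'v qop = "complex ^ ('v \<Rightarrow> bool) ^ ('v \<Rightarrow> bool)"

definition dagger :: "complex ^ 'm ^ 'm \<Rightarrow> complex ^ 'm ^ 'm" where
  "dagger A = (\<chi> i j. cnj (A $ j $ i))"

definition unitary_op :: "complex ^ 'm ^ 'm \<Rightarrow> bool" where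
  "unitary_op U \<longleftrightarrow> dagger U ** U = mat 1 \<and> U ** dagger U = mat 1"

definition observable :: "complex ^ 'm ^ 'm \<Rightarrow> bool" where
  "observable A \<longleftrightarrow> dagger A = A"

definition is_state :: "complex ^ 'm \<Rightarrow> bool" where
  "is_state \<psi> \<longleftrightarrow> norm \<psi> = 1"

definition expect :: "complex ^ 'm \<Rightarrow> complex ^ 'm ^ 'm \<Rightarrow> complex" where
  "expect \<psi> A = (\<Sum>x\<in>UNIV. cnj (\<psi> $ x) * (A *v \<psi>) $ x)"

definition tensor_state :: "('v::finite \<Rightarrow> complex ^ bool) \<Rightarrow> 'v qstate" where
  "tensor_state \<phi> = (\<chi> x. \<Prod>v\<in>UNIV. \<phi> v $ x v)"

definition tensor_op :: "('v::finite \<Rightarrow> complex ^ bool ^ bool) \<Rightarrow> 'v qop" where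
  "tensor_op A = (\<chi> x y. \<Prod>v\<in>UNIV. A v $ x v $ y v)"

definition pauli_X :: "complex ^ bool ^ bool" where
  "pauli_X = (\<chi> a b. if a \<noteq> b then 1 else 0)"

definition pauli_Z :: "complex ^ bool ^ bool" where
  "pauli_Z = (\<chi> a b. if a = b then (if a then - 1 else 1) else 0)"

definition Z_at :: "'v::finite \<Rightarrow> 'v qop" where
  "Z_at v = tensor_op (\<lambda>w. if w = v then pauli_Z else mat 1)"

definition X_all :: "'v::finite qop" where
  "X_all = tensor_op (\<lambda>_. pauli_X)"

text \<open>
  \<open>A\<close> is supported on \<open>S\<close> if it is the tensor product of an operator \<open>a\<close> on the qubits in \<open>S\<close>
  with the identity on the other qubits. The basis states of the qubits in \<open>S\<close> are
  represented by the restrictions of bit assignments to \<open>S\<close>.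
\<close>

definition supported_on :: "'v::finite set \<Rightarrow> 'v qop \<Rightarrow> bool" where
  "supported_on S A \<longleftrightarrow>
     (\<exists>a :: ('v \<Rightarrow> bool) \<Rightarrow> ('v \<Rightarrow> bool) \<Rightarrow> complex. \<forall>x y.
        A $ x $ y = (if \<forall>w. w \<notin> S \<longrightarrow> x w = y w then a (restrict x S) (restrict y S) else 0))"

definition product_state :: "'v::finite qstate \<Rightarrow> bool" where
  "product_state \<psi> \<longleftrightarrow> (\<exists>\<phi>. (\<forall>v. is_state (\<phi> v)) \<and> \<psi> = tensor_state \<phi>)"

definition Z2_symmetric_state :: "'v::finite qstate \<Rightarrow> bool" where
  "Z2_symmetric_state \<psi> \<longleftrightarrow> X_all *v \<psi> = \<psi>"

definition Z2_symmetric_op :: "'v::finite qop \<Rightarrow> bool" where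
  "Z2_symmetric_op U \<longleftrightarrow> X_all ** U ** X_all = U"

text \<open>A graph with vertex set \<open>UNIV :: 'v set\<close> is given by its set of (two-element) edges.\<close>

definition adjacency :: "'v set set \<Rightarrow> ('v \<times> 'v) set" where
  "adjacency E = {(u, v). {u, v} \<in> E}"

text \<open>The distance is the length of a shortest walk, and \<open>\<infinity>\<close> if there is none.\<close>

definition graph_dist :: "'v set set \<Rightarrow> 'v \<Rightarrow> 'v \<Rightarrow> enat" where
  "graph_dist E u v = (INF m \<in> {m. (u, v) \<in> adjacency E ^^ m}. enat m)"

definition graph_ball :: "'v set set \<Rightarrow> 'v \<Rightarrow> nat \<Rightarrow> 'v set" where
  "graph_ball E v R = {w. graph_dist E v w \<le> enat R}"

definition has_range :: "'v::finite set set \<Rightarrow> nat \<Rightarrow> 'v qop \<Rightarrow> bool" where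
  "has_range E R U \<longleftrightarrow>
     (\<forall>v A. observable A \<and> supported_on {v} A \<longrightarrow>
        supported_on (graph_ball E v R) (dagger U ** A ** U))"

definition Z2_prepared :: "'v::finite set set \<Rightarrow> nat \<Rightarrow> 'v qstate \<Rightarrow> bool" where
  "Z2_prepared E R \<psi> \<longleftrightarrow>
     (\<exists>U \<phi>. unitary_op U \<and> Z2_symmetric_op U \<and> has_range E R U \<and>
            product_state \<phi> \<and> Z2_symmetric_state \<phi> \<and> \<psi> = U *v \<phi>)"

text \<open>
  \<open>f\<close> labels the vertices cyclically by \<open>0, \<dots>, n - 1\<close>, where \<open>n = CARD('v)\<close>.
  This is the usual ring graph only for \<open>n \<ge> 3\<close>.
\<close>

definition ring_graph :: "(nat \<Rightarrow> 'v::finite) \<Rightarrow> 'v set set \<Rightarrow> bool" where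
  "ring_graph f E \<longleftrightarrow>
     bij_betw f {0..<CARD('v)} UNIV \<and>
     E = {{f i, f (Suc i mod CARD('v))} | i. i < CARD('v)}"

definition H_MaxCut :: "(nat \<Rightarrow> 'v::finite) \<Rightarrow> 'v qop" where
  "H_MaxCut f =
     (\<Sum>i<CARD('v). (1/2) *\<^sub>R (mat 1 - Z_at (f i) ** Z_at (f (Suc i mod CARD('v)))))"

end

theory Submission
  imports Defs
begin

text \<open>
  In a state prepared by a symmetric circuit of range \<open>R\<close>, the observables \<open>Z\<^sub>u\<close> and \<open>Z\<^sub>v\<close> are
  uncorrelated once the \<open>R\<close>-balls around \<open>u\<close> and \<open>v\<close> are disjoint, because in the Heisenberg picture
  they act on disjoint sets of qubits of a product state. Each of them has expectation \<open>0\<close>, as \<open>Z\<^sub>u\<close>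
  anticommutes with the symmetry. Now cut the ring into \<open>k\<close> arcs of odd length \<open>2R + 1\<close>. In each arc,
  the product of the signs \<open>\<sigma>\<^sub>e Z Z\<close> telescopes to \<open>\<plusminus>Z Z\<close> on the two ends, which has mean \<open>0\<close>.
  Whenever all the signs of an arc equal \<open>-1\<close> this product is \<open>-1\<close>, so the sum of \<open>1 + \<sigma>\<^sub>e Z Z\<close> over the
  arc is bounded below by \<open>1\<close> plus the product, and the mean of that sum is at least \<open>1\<close>.
\<close>

subsection \<open>Operators diagonal in the computational basis\<close>

text \<open>Real entries keep expectations real, so the complex order in the final bounds reduces to
  the order on the reals.\<close>

definition diag_op :: "('m::finite \<Rightarrow> real) \<Rightarrow> complex ^ 'm ^ 'm" where
  "diag_op d = (\<chi> x y. if x = y then of_real (d x) else 0)"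

text \<open>The eigenvalue of \<open>Z_at v\<close> on the basis state \<open>x\<close>.\<close>

definition spin :: "('v \<Rightarrow> bool) \<Rightarrow> 'v \<Rightarrow> real" where
  "spin x v = (if x v then -1 else 1)"

lemma spin_square [simp]: "spin x v * spin x v = 1"
  by (simp add: spin_def)

lemma spin_cases: "spin x v = -1 \<or> spin x v = 1"
  by (simp add: spin_def)

lemma mat_1_eq_diag_op: "mat 1 = diag_op (\<lambda>_. 1)"
  by (simp add: diag_op_def mat_def vec_eq_iff)

lemma tensor_op_diag:
  assumes "\<And>w a b. a \<noteq> b \<Longrightarrow> A w $ a $ b = 0"
  shows "tensor_op A $ x $ y = (if x = y then \<Prod>w\<in>UNIV. A w $ x w $ x w else 0)"
proof (cases "x = y")
  case False
  then obtain w where "x w \<noteq> y w" by blast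
  then have "(\<Prod>w\<in>UNIV. A w $ x w $ y w) = 0"
    using assms[of "x w" "y w" w] by (intro prod_zero bexI[of _ w]) auto
  with False show ?thesis by (simp add: tensor_op_def)
qed (simp add: tensor_op_def)

lemma Z_at_eq_diag_op: "Z_at v = diag_op (\<lambda>x. spin x v)"
proof -
  have "(\<Prod>w\<in>UNIV. (if w = v then pauli_Z else mat 1) $ x w $ x w) = complex_of_real (spin x v)"
    for x :: "'a \<Rightarrow> bool"
  proof -
    have "(\<Prod>w\<in>UNIV. (if w = v then pauli_Z else mat 1) $ x w $ x w)
        = (\<Prod>w\<in>UNIV. if w = v then complex_of_real (spin x w) else 1)"
      by (intro prod.cong) (auto simp: pauli_Z_def mat_def spin_def)
    then show ?thesis by (simp add: prod.delta)
  qed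
  then show ?thesis
    unfolding Z_at_def diag_op_def vec_eq_iff
    by (subst tensor_op_diag) (auto simp: pauli_Z_def mat_def)
qed

lemma diag_op_mult: "diag_op c ** diag_op d = diag_op (\<lambda>x. c x * d x)"
  by (simp add: matrix_matrix_mult_def diag_op_def vec_eq_iff mult_delta_left)

lemma diag_op_add: "diag_op c + diag_op d = diag_op (\<lambda>x. c x + d x)"
  by (simp add: diag_op_def vec_eq_iff)

lemma diag_op_diff: "diag_op c - diag_op d = diag_op (\<lambda>x. c x - d x)"
  by (simp add: diag_op_def vec_eq_iff)

lemma diag_op_scaleR: "r *\<^sub>R diag_op d = diag_op (\<lambda>x. r * d x)"
  by (simp add: diag_op_def vec_eq_iff of_real_def)

lemma diag_op_sum: "(\<Sum>i\<in>I. diag_op (d i)) = diag_op (\<lambda>x. \<Sum>i\<in>I. d i x)"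
  by (simp add: diag_op_def vec_eq_iff)

text \<open>The Born rule: a diagonal observable averages a classical function with weights
  \<open>(cmod (\<psi> $ x))\<^sup>2\<close>, so inequalities can be checked one bit assignment at a
  time.\<close>

lemma expect_diag_op:
  "expect \<psi> (diag_op d) = complex_of_real (\<Sum>x\<in>UNIV. (cmod (\<psi> $ x))\<^sup>2 * d x)"
proof -
  have "(diag_op d *v \<psi>) $ x = of_real (d x) * \<psi> $ x" for x
    by (simp add: matrix_vector_mult_def diag_op_def mult_delta_left)
  then have "expect \<psi> (diag_op d) = (\<Sum>x\<in>UNIV. (\<psi> $ x * cnj (\<psi> $ x)) * of_real (d x))"
    by (simp add: expect_def mult_ac)
  then show ?thesis
    by (simp only: complex_norm_square[symmetric] of_real_sum of_real_mult)
qed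

lemma is_state_iff: "is_state \<psi> \<longleftrightarrow> (\<Sum>x\<in>UNIV. (cmod (\<psi> $ x))\<^sup>2) = 1"
  by (simp add: is_state_def norm_vec_def L2_set_def)

lemma is_state_iff_expect: "is_state \<psi> \<longleftrightarrow> expect \<psi> (mat 1) = 1"
  unfolding is_state_iff mat_1_eq_diag_op expect_diag_op of_real_eq_1_iff by simp

subsection \<open>Expectations and the symmetry\<close>

text \<open>Passage to the Heisenberg picture: the circuit moves from the state to the
  observable.\<close>

lemma expect_matrix_vector_mult:
  "expect (U *v \<phi>) A = expect \<phi> (dagger U ** A ** U)"
proof -
  have "expect \<phi> (dagger U ** A ** U) = (\<Sum>x\<in>UNIV. cnj (\<phi> $ x) * (dagger U *v (A *v (U *v \<phi>))) $ x)"
    by (simp add: expect_def matrix_vector_mul_assoc matrix_mul_assoc)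
  also have "\<dots> = (\<Sum>x\<in>UNIV. \<Sum>y\<in>UNIV. cnj (U $ y $ x * \<phi> $ x) * (A *v (U *v \<phi>)) $ y)"
    by (subst (1) matrix_vector_mult_def) (simp add: dagger_def sum_distrib_left mult_ac)
  also have "\<dots> = (\<Sum>y\<in>UNIV. \<Sum>x\<in>UNIV. cnj (U $ y $ x * \<phi> $ x) * (A *v (U *v \<phi>)) $ y)"
    by (rule sum.swap)
  also have "\<dots> = expect (U *v \<phi>) A"
    unfolding expect_def
    by (intro sum.cong refl) (simp add: matrix_vector_mult_def[of U \<phi>] sum_distrib_right)
  finally show ?thesis ..
qed

lemma X_all_mult_component: "(X_all *v \<psi>) $ x = \<psi> $ (\<lambda>v. \<not> x v)"
proof -
  have "X_all $ x $ y = (if y = (\<lambda>v. \<not> x v) then 1 else 0)" for y :: "'a \<Rightarrow> bool"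
  proof (cases "y = (\<lambda>v. \<not> x v)")
    case False
    then obtain w where "x w = y w" by blast
    then have "(\<Prod>w\<in>UNIV. pauli_X $ x w $ y w) = 0"
      by (intro prod_zero bexI[of _ w]) (auto simp: pauli_X_def)
    with False show ?thesis by (simp add: X_all_def tensor_op_def)
  qed (simp add: X_all_def tensor_op_def pauli_X_def)
  then show ?thesis
    by (simp add: matrix_vector_mult_def mult_delta_left)
qed

text \<open>Flipping all bits preserves the weights and negates the spin, so the mean equals its own
  negative.\<close>

lemma expect_Z_at_symmetric:
  assumes "Z2_symmetric_state \<psi>"
  shows "expect \<psi> (Z_at v) = 0"
proof -
  have flip: "\<psi> $ (\<lambda>v. \<not> x v) = \<psi> $ x" for x
    using assms X_all_mult_component[of \<psi> x] by (simp add: Z2_symmetric_state_def)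
  have "(\<Sum>x\<in>UNIV. (cmod (\<psi> $ x))\<^sup>2 * spin x v) = (\<Sum>x\<in>UNIV. - ((cmod (\<psi> $ x))\<^sup>2 * spin x v))"
    by (rule sum.reindex_bij_witness[of _ "\<lambda>x v. \<not> x v" "\<lambda>x v. \<not> x v"])
      (auto simp: flip spin_def)
  then show ?thesis
    by (simp add: Z_at_eq_diag_op expect_diag_op sum_negf)
qed

lemma Z2_symmetric_op_mult_state:
  assumes "Z2_symmetric_op U" "Z2_symmetric_state \<phi>"
  shows "Z2_symmetric_state (U *v \<phi>)"
  using assms unfolding Z2_symmetric_op_def Z2_symmetric_state_def
  by (metis matrix_vector_mul_assoc)

subsection \<open>Factorization over disjoint supports\<close>

lemma product_state_is_state:
  assumes "product_state \<phi>"
  shows "is_state \<phi>"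
proof -
  obtain \<xi> where \<xi>: "\<And>v. is_state (\<xi> v)" "\<phi> = tensor_state \<xi>"
    using assms by (auto simp: product_state_def)
  have "(\<Sum>x\<in>UNIV. (cmod (\<phi> $ x))\<^sup>2) = (\<Sum>x\<in>UNIV. \<Prod>v\<in>UNIV. (cmod (\<xi> v $ x v))\<^sup>2)"
    by (simp add: \<xi> tensor_state_def prod_norm[symmetric] prod_power_distrib)
  also have "\<dots> = (\<Prod>v\<in>UNIV. \<Sum>b\<in>UNIV. (cmod (\<xi> v $ b))\<^sup>2)"
    using prod_sum_PiE[of UNIV "\<lambda>_. UNIV" "\<lambda>v b. (cmod (\<xi> v $ b))\<^sup>2"]
    by (simp add: PiE_UNIV_domain)
  also have "\<dots> = 1"
    using \<xi>(1) by (simp add: is_state_iff)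
  finally show ?thesis by (simp add: is_state_iff)
qed

text \<open>Serves to exchange parts between two copies of the system in the factorization
  argument.\<close>

definition splice_on :: "'v set \<Rightarrow> ('v \<Rightarrow> 'b) \<Rightarrow> ('v \<Rightarrow> 'b) \<Rightarrow> 'v \<Rightarrow> 'b" where
  "splice_on S x y = (\<lambda>v. if v \<in> S then x v else y v)"

lemma splice_on_simps [simp]:
  "v \<in> S \<Longrightarrow> splice_on S x y v = x v"
  "v \<notin> S \<Longrightarrow> splice_on S x y v = y v"
  "splice_on S (splice_on S x y) z = splice_on S x z"
  "splice_on S x (splice_on S y z) = splice_on S x z"
  "splice_on S x x = x"
  by (auto simp: splice_on_def)

lemma splice_on_eq_left: "(\<And>v. v \<notin> S \<Longrightarrow> x v = y v) \<Longrightarrow> splice_on S x y = x"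
  by (auto simp: splice_on_def)

lemma splice_on_eq_right: "(\<And>v. v \<in> S \<Longrightarrow> x v = y v) \<Longrightarrow> splice_on S x y = y"
  by (auto simp: splice_on_def)

text \<open>The exchange only permutes the two factors at each vertex; this is where the product
  form of the state enters.\<close>

lemma tensor_state_splice_on:
  "tensor_state \<xi> $ splice_on S x y * tensor_state \<xi> $ splice_on S y x = tensor_state \<xi> $ x * tensor_state \<xi> $ y"
  unfolding tensor_state_def
  by (simp add: prod.distrib[symmetric]) (auto simp: splice_on_def intro!: prod.cong)

lemma supported_on_zero:
  assumes "supported_on S A" "w \<notin> S" "x w \<noteq> y w"
  shows "A $ x $ y = 0"
proof -
  obtain a where "A $ x $ y = (if \<forall>w. w \<notin> S \<longrightarrow> x w = y w then a (restrict x S) (restrict y S) else 0)"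
    using assms(1) unfolding supported_on_def by blast
  with assms(2,3) show ?thesis by auto
qed

text \<open>An entry sees the qubits outside \<open>S\<close> only through whether they agree, so
  they may be replaced as long as agreement is kept.\<close>

lemma supported_on_cong:
  assumes "supported_on S A" "\<And>w. w \<in> S \<Longrightarrow> x w = x' w" "\<And>w. w \<in> S \<Longrightarrow> y w = y' w"
    and "\<And>w. w \<notin> S \<Longrightarrow> x w = y w \<longleftrightarrow> x' w = y' w"
  shows "A $ x $ y = A $ x' $ y'"
proof -
  have "restrict x S = restrict x' S" "restrict y S = restrict y' S"
    using assms by (auto simp: restrict_def)
  moreover have "(\<forall>w. w \<notin> S \<longrightarrow> x w = y w) \<longleftrightarrow> (\<forall>w. w \<notin> S \<longrightarrow> x' w = y' w)"
    using assms(4) by blast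
  moreover obtain a where
    "\<And>x y. A $ x $ y = (if \<forall>w. w \<notin> S \<longrightarrow> x w = y w then a (restrict x S) (restrict y S) else 0)"
    using assms(1) unfolding supported_on_def by blast
  ultimately show ?thesis by presburger
qed

lemma sum_UNIV_prod4:
  "(\<Sum>x\<in>UNIV. \<Sum>y\<in>UNIV. \<Sum>z\<in>UNIV. \<Sum>w\<in>UNIV. g x y z w) = (\<Sum>(x, y, z, w)\<in>UNIV. g x y z w)"
  by (simp add: sum.cartesian_product)

text \<open>
  Both sides become sums over quadruples after multiplying the left one by \<open>expect \<phi> (mat 1) = 1\<close>. On the
  quadruples with nonzero terms, exchanging the parts outside \<open>S\<close> of the two copies
  of the system is a bijection which preserves the terms.
\<close>

lemma expect_mult_disjoint:
  fixes \<phi> :: "'v::finite qstate"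
  assumes \<phi>: "product_state \<phi>" and A: "supported_on S A" and B: "supported_on T B"
    and disj: "S \<inter> T = {}"
  shows "expect \<phi> (A ** B) = expect \<phi> A * expect \<phi> B"
proof -
  let ?P = "{(x :: 'v \<Rightarrow> bool, y :: 'v \<Rightarrow> bool, z :: 'v \<Rightarrow> bool, w :: 'v \<Rightarrow> bool).
      (\<forall>v. v \<notin> S \<longrightarrow> x v = y v) \<and> (\<forall>v. v \<in> S \<longrightarrow> z v = w v)}"
  let ?Q = "{(x :: 'v \<Rightarrow> bool, y :: 'v \<Rightarrow> bool, z :: 'v \<Rightarrow> bool, w :: 'v \<Rightarrow> bool).
      (\<forall>v. v \<notin> S \<longrightarrow> x v = y v) \<and> (\<forall>v. v \<in> S \<longrightarrow> y v = z v)}"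
  let ?p = "\<lambda>x y z w. cnj (\<phi> $ x) * A $ x $ y * \<phi> $ y * (cnj (\<phi> $ z) * B $ z $ w * \<phi> $ w)"
  let ?q = "\<lambda>x y z w. cnj (\<phi> $ x) * A $ x $ y * B $ y $ z * \<phi> $ z * (cnj (\<phi> $ w) * \<phi> $ w)"
  obtain \<xi> where \<xi>: "\<phi> = tensor_state \<xi>"
    using \<phi> by (auto simp: product_state_def)
  have swap: "\<phi> $ splice_on S x y * \<phi> $ splice_on S y x = \<phi> $ x * \<phi> $ y" for x y
    by (simp add: \<xi> tensor_state_splice_on)
  have A0: "x v = y v" if "A $ x $ y \<noteq> 0" "v \<notin> S" for x y v
    using supported_on_zero[OF A, of v x y] that by auto
  \<comment> \<open>A nonzero entry forces agreement outside \<open>T\<close>, hence on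
    \<open>S\<close> by disjointness.\<close>
  have B0: "x v = y v" if "B $ x $ y \<noteq> 0" "v \<in> S" for x y v
    using supported_on_zero[OF B, of v x y] that disj by auto
  have e: "expect \<phi> M = (\<Sum>x\<in>UNIV. \<Sum>y\<in>UNIV. cnj (\<phi> $ x) * M $ x $ y * \<phi> $ y)" for M
    by (simp add: expect_def matrix_vector_mult_def sum_distrib_left mult_ac)
  have one: "(\<Sum>w\<in>UNIV. cnj (\<phi> $ w) * \<phi> $ w) = 1"
    using product_state_is_state[OF \<phi>] by (simp add: is_state_iff_expect expect_def)
  have "expect \<phi> A * expect \<phi> B
      = (\<Sum>x\<in>UNIV. \<Sum>y\<in>UNIV. \<Sum>z\<in>UNIV. \<Sum>w\<in>UNIV. ?p x y z w)"
    unfolding e by (simp only: sum_distrib_right) (simp only: sum_distrib_left)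
  also have "\<dots> = (\<Sum>(x, y, z, w)\<in>UNIV. ?p x y z w)"
    by (rule sum_UNIV_prod4)
  also have "\<dots> = (\<Sum>(x, y, z, w)\<in>?P. ?p x y z w)"
    by (rule sum.mono_neutral_right) (auto dest: A0 B0)
  \<comment> \<open>Under \<open>j\<close>, the first copy follows a path: \<open>A\<close> links
    \<open>x\<close> to \<open>y\<close> on \<open>S\<close> while the rest stays \<open>z\<close>,
    then \<open>B\<close> links \<open>z\<close> to \<open>w\<close> outside \<open>S\<close>. The
    leftover parts, \<open>z\<close> on \<open>S\<close> and \<open>x\<close> elsewhere, form the
    idle second copy.\<close>
  also have "\<dots> = (\<Sum>(x, y, z, w)\<in>?Q. ?q x y z w)"
  proof (rule sum.reindex_bij_witness[where
      j = "\<lambda>(x, y, z, w). (splice_on S x z, splice_on S y z, splice_on S y w, splice_on S z x)" and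
      i = "\<lambda>(x, y, z, w). (splice_on S x w, splice_on S y w, splice_on S w x, splice_on S w z)"])
    fix t assume "t \<in> ?P"
    then obtain x y z w where t: "t = (x, y, z, w)"
      and xy: "\<And>v. v \<notin> S \<Longrightarrow> x v = y v" and zw: "\<And>v. v \<in> S \<Longrightarrow> z v = w v"
      by auto
    \<comment> \<open>On \<open>?P\<close> the leftover of the bras is also that of the kets, so
      \<open>swap\<close> applies to both pairs.\<close>
    have "splice_on S z x = splice_on S w y"
      using xy zw by (auto simp: splice_on_def)
    then have 1: "\<phi> $ splice_on S y w * \<phi> $ splice_on S z x = \<phi> $ y * \<phi> $ w"
      using swap[of y w] by simp
    have 2: "cnj (\<phi> $ splice_on S x z) * cnj (\<phi> $ splice_on S z x) = cnj (\<phi> $ x) * cnj (\<phi> $ z)"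
      using swap[of x z] by (simp flip: complex_cnj_mult)
    have 3: "A $ splice_on S x z $ splice_on S y z = A $ x $ y"
      by (rule supported_on_cong[OF A]) (auto simp: splice_on_def xy)
    have 4: "B $ splice_on S y z $ splice_on S y w = B $ z $ w"
      by (rule supported_on_cong[OF B]) (use disj zw in \<open>auto simp: splice_on_def\<close>)
    have "?q (splice_on S x z) (splice_on S y z) (splice_on S y w) (splice_on S z x)
        = (cnj (\<phi> $ splice_on S x z) * cnj (\<phi> $ splice_on S z x)) * A $ splice_on S x z $ splice_on S y z
          * B $ splice_on S y z $ splice_on S y w * (\<phi> $ splice_on S y w * \<phi> $ splice_on S z x)"
      by (simp only: mult_ac)
    also have "\<dots> = ?p x y z w"
      unfolding 1 2 3 4 by (simp only: mult_ac)
    finally show "(case case t of (x, y, z, w) \<Rightarrow>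
          (splice_on S x z, splice_on S y z, splice_on S y w, splice_on S z x) of (x, y, z, w) \<Rightarrow> ?q x y z w)
        = (case t of (x, y, z, w) \<Rightarrow> ?p x y z w)"
      by (simp add: t)
  qed (simp_all add: splice_on_eq_left splice_on_eq_right split: prod.splits)
  also have "\<dots> = (\<Sum>(x, y, z, w)\<in>UNIV. ?q x y z w)"
    by (rule sum.mono_neutral_left) (auto dest: A0 B0)
  also have "\<dots> = (\<Sum>x\<in>UNIV. \<Sum>y\<in>UNIV. \<Sum>z\<in>UNIV. \<Sum>w\<in>UNIV. ?q x y z w)"
    by (rule sum_UNIV_prod4[symmetric])
  also have "\<dots> = (\<Sum>x\<in>UNIV. \<Sum>y\<in>UNIV. \<Sum>z\<in>UNIV. cnj (\<phi> $ x) * A $ x $ y * B $ y $ z * \<phi> $ z)"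
    by (simp add: sum_distrib_left[symmetric] one)
  also have "\<dots> = (\<Sum>x\<in>UNIV. \<Sum>z\<in>UNIV. \<Sum>y\<in>UNIV. cnj (\<phi> $ x) * A $ x $ y * B $ y $ z * \<phi> $ z)"
    by (intro sum.cong refl sum.swap)
  also have "\<dots> = expect \<phi> (A ** B)"
    unfolding e by (simp add: matrix_matrix_mult_def sum_distrib_left sum_distrib_right mult_ac)
  finally show ?thesis ..
qed

section \<open>Decorrelation of distant spins\<close>

lemma observable_Z_at: "observable (Z_at v)"
  by (simp add: observable_def dagger_def Z_at_eq_diag_op diag_op_def vec_eq_iff)

lemma supported_on_Z_at: "supported_on {v} (Z_at v)"
  unfolding supported_on_def Z_at_eq_diag_op diag_op_def
  by (rule exI[of _ "\<lambda>x y. if x v = y v then of_real (spin x v) else 0"])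
    (auto simp: spin_def fun_eq_iff)

lemma Z2_prepared_is_state:
  assumes "Z2_prepared E R \<psi>"
  shows "is_state \<psi>"
proof -
  obtain U \<phi> where U: "dagger U ** U = mat 1" "product_state \<phi>" "\<psi> = U *v \<phi>"
    using assms by (auto simp: Z2_prepared_def unitary_op_def)
  then have "expect \<psi> (mat 1) = expect \<phi> (mat 1)"
    by (simp add: expect_matrix_vector_mult)
  with product_state_is_state[OF U(2)] show ?thesis
    by (simp add: is_state_iff_expect)
qed

text \<open>The Heisenberg images of the two spins live on disjoint balls, so the mean factorizes
  over the product state, and symmetry makes a factor vanish.\<close>

lemma expect_ZZ_far:
  assumes "Z2_prepared E R \<psi>" and disj: "graph_ball E u R \<inter> graph_ball E v R = {}"
  shows "expect \<psi> (Z_at u ** Z_at v) = 0"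
proof -
  obtain U \<phi> where U: "U ** dagger U = mat 1" "Z2_symmetric_op U" "has_range E R U"
    "product_state \<phi>" "Z2_symmetric_state \<phi>" "\<psi> = U *v \<phi>"
    using assms by (auto simp: Z2_prepared_def unitary_op_def)
  have supp: "supported_on (graph_ball E w R) (dagger U ** Z_at w ** U)" for w
    using U(3) observable_Z_at supported_on_Z_at by (auto simp: has_range_def)
  \<comment> \<open>Inserting \<open>U ** dagger U = mat 1\<close> splits the conjugated product
    into two conjugated factors.\<close>
  have "dagger U ** (Z_at u ** Z_at v) ** U = dagger U ** Z_at u ** (U ** dagger U) ** Z_at v ** U"
    by (simp add: U(1) matrix_mul_assoc)
  also have "\<dots> = (dagger U ** Z_at u ** U) ** (dagger U ** Z_at v ** U)"
    by (simp only: matrix_mul_assoc)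
  finally have "expect \<psi> (Z_at u ** Z_at v) = expect \<psi> (Z_at u) * expect \<psi> (Z_at v)"
    using expect_mult_disjoint[OF U(4) supp supp disj] by (simp add: U(6) expect_matrix_vector_mult)
  also have "expect \<psi> (Z_at u) = 0"
    using expect_Z_at_symmetric Z2_symmetric_op_mult_state U by blast
  finally show ?thesis by simp
qed

subsection \<open>The ring\<close>

text \<open>An infimum of naturals in \<open>enat\<close> is attained unless the set is empty, and
  then it is infinite and exceeds \<open>R\<close>.\<close>

lemma graph_ballE:
  assumes "w \<in> graph_ball E v R"
  obtains m where "m \<le> R" "(v, w) \<in> adjacency E ^^ m"
proof -
  let ?M = "{m. (v, w) \<in> adjacency E ^^ m}"
  have le: "(INF m\<in>?M. enat m) \<le> enat R"
    using assms by (simp add: graph_ball_def graph_dist_def)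
  have "?M \<noteq> {}"
  proof
    assume "?M = {}"
    then have "(INF m\<in>?M. enat m) = top" by (simp only: image_empty Inf_empty)
    with le show False by (simp add: top_enat_def)
  qed
  then have "(INF m\<in>?M. enat m) \<in> enat ` ?M"
    using wellorder_InfI[of _ "enat ` ?M"] by blast
  with le that show ?thesis by auto
qed

text \<open>The displacement is an integer because edges can be crossed both ways; reduction on
  \<open>int\<close> handles the wrap-around below 0.\<close>

lemma ring_adjacency:
  assumes "ring_graph f E" and n: "CARD('v::finite) = n" and "i < n" and "(f i, w :: 'v) \<in> adjacency E"
  obtains d :: int where "\<bar>d\<bar> \<le> 1" "w = f (nat ((int i + d) mod int n))"
proof -
  have bij: "bij_betw f {0..<n} UNIV" and E: "E = {{f i, f (Suc i mod n)} | i. i < n}"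
    using assms by (auto simp: ring_graph_def)
  from assms(4) obtain j where j: "j < n" "{f i, w} = {f j, f (Suc j mod n)}"
    by (auto simp: adjacency_def E)
  have inj: "a = b" if "f a = f b" "a < n" "b < n" for a b
    using bij that by (auto simp: bij_betw_def inj_on_def)
  from j(2) consider "f i = f j" "w = f (Suc j mod n)" | "f i = f (Suc j mod n)" "w = f j"
    by (auto simp: doubleton_eq_iff)
  then show thesis
  proof cases
    case 1
    then have "i = j" using inj j assms by blast
    with 1 have "w = f (nat ((int i + 1) mod int n))"
      by (simp add: nat_mod_distrib nat_add_distrib)
    then show thesis by (intro that[of 1]) auto
  next
    case 2
    then have "i = Suc j mod n" using inj j assms by (metis mod_less_divisor gr_implies_not0 not_gr0)
    then have "int i = (int j + 1) mod int n" by (simp add: zmod_int add.commute)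
    then have "(int i + (-1)) mod int n = (int j + 1 + (-1)) mod int n"
      by (metis mod_add_left_eq)
    with j(1) have "nat ((int i + (-1)) mod int n) = j" by simp
    with 2 show thesis by (intro that[of "-1"]) auto
  qed
qed

text \<open>Displacements add along a walk, each step contributing at most 1 in absolute
  value.\<close>

lemma ring_walk:
  assumes "ring_graph f E" and "CARD('v::finite) = n" and "i < n" and "(f i, w :: 'v) \<in> adjacency E ^^ m"
  shows "\<exists>d::int. \<bar>d\<bar> \<le> int m \<and> w = f (nat ((int i + d) mod int n))"
  using assms(4)
proof (induction m arbitrary: w)
  case 0
  with \<open>i < n\<close> show ?case by (intro exI[of _ 0]) auto
next
  case (Suc m)
  then obtain u where u: "(f i, u) \<in> adjacency E ^^ m" "(u, w) \<in> adjacency E" by auto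
  then obtain d :: int where d: "\<bar>d\<bar> \<le> int m" "u = f (nat ((int i + d) mod int n))"
    using Suc.IH by blast
  let ?j = "nat ((int i + d) mod int n)"
  have "?j < n" using \<open>i < n\<close> by (simp add: nat_less_iff)
  then obtain d' :: int where d': "\<bar>d'\<bar> \<le> 1" "w = f (nat ((int ?j + d') mod int n))"
    using ring_adjacency[OF assms(1,2)] u d by metis
  have "(int ?j + d') mod int n = (int i + (d + d')) mod int n"
    using \<open>i < n\<close> by (simp add: mod_simps add.assoc)
  with d d' show ?case by (intro exI[of _ "d + d'"]) auto
qed

text \<open>A common vertex would make \<open>n\<close> divide \<open>l\<close> plus a shift of
  absolute value at most \<open>2 * R\<close>; the two bounds on \<open>l\<close> put this number
  strictly between 0 and \<open>n\<close>.\<close>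

lemma ring_balls_disjoint:
  assumes ring: "ring_graph f E" and n: "CARD('v::finite) = n" and "i < n"
    and far: "2 * R < l" "l + 2 * R < n"
  shows "graph_ball E (f i :: 'v) R \<inter> graph_ball E (f ((i + l) mod n)) R = {}"
proof (rule ccontr)
  let ?j = "(i + l) mod n"
  assume "\<not> ?thesis"
  then obtain w m m' where w: "m \<le> R" "(f i, w) \<in> adjacency E ^^ m"
    "m' \<le> R" "(f ?j, w) \<in> adjacency E ^^ m'"
    by (metis disjoint_iff graph_ballE)
  have "?j < n" using \<open>i < n\<close> by simp
  obtain d d' :: int where d: "\<bar>d\<bar> \<le> int m" "w = f (nat ((int i + d) mod int n))"
    and d': "\<bar>d'\<bar> \<le> int m'" "w = f (nat ((int ?j + d') mod int n))"
    using ring_walk[OF ring n] w \<open>i < n\<close> \<open>?j < n\<close> by meson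
  have "inj_on f {0..<n}" using ring n by (simp add: ring_graph_def bij_betw_def)
  then have "nat ((int i + d) mod int n) = nat ((int ?j + d') mod int n)"
    by (rule inj_onD) (use d d' \<open>i < n\<close> in \<open>auto simp: nat_less_iff\<close>)
  then have "(int i + d) mod int n = (int ?j + d') mod int n"
    using \<open>i < n\<close> by (simp add: nat_eq_iff)
  also have "\<dots> = (int i + (int l + d')) mod int n"
    by (simp add: zmod_int mod_simps add.assoc)
  finally have "int n dvd (int i + (int l + d')) - (int i + d)"
    by (metis mod_eq_dvd_iff)
  then have "int n dvd int l + d' - d" by (simp add: algebra_simps)
  moreover have "0 < int l + d' - d" "int l + d' - d < int n"
    using d d' w far by auto
  ultimately show False using zdvd_not_zless by blast
qed

section \<open>Energy bound from cutting the ring into arcs\<close>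

text \<open>If some sign is 1, its term is 2, which is at least 1 plus any product of signs.
  Otherwise all signs are -1, and oddness makes both sides 0.\<close>

lemma sum_signs_ge_prod:
  fixes t :: "'a \<Rightarrow> real"
  assumes "finite I" "odd (card I)" and t: "\<And>i. i \<in> I \<Longrightarrow> t i = -1 \<or> t i = 1"
  shows "1 + (\<Prod>i\<in>I. t i) \<le> (\<Sum>i\<in>I. 1 + t i)"
proof (cases "\<exists>i\<in>I. t i = 1")
  case True
  then obtain i where i: "i \<in> I" "t i = 1" by blast
  have "\<bar>\<Prod>i\<in>I. t i\<bar> = (\<Prod>i\<in>I. \<bar>t i\<bar>)" by (simp add: abs_prod)
  also have "\<dots> = 1" using t by (intro prod.neutral) fastforce
  finally have "1 + (\<Prod>i\<in>I. t i) \<le> 1 + t i" using i by linarith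
  also have "\<dots> \<le> (\<Sum>i\<in>I. 1 + t i)"
    using t by (intro member_le_sum i(1) \<open>finite I\<close>) force
  finally show ?thesis .
next
  case False
  then have "(\<Prod>i\<in>I. t i) = (\<Prod>i\<in>I. -1)" "(\<Sum>i\<in>I. 1 + t i) = (\<Sum>i\<in>I. 0)"
    using t by (auto intro!: prod.cong sum.neutral)
  with \<open>odd (card I)\<close> show ?thesis by simp
qed

text \<open>Every interior spin occurs twice and squares to 1.\<close>

lemma prod_spin_telescope:
  "(\<Prod>r<l. spin x (g r) * spin x (g (Suc r))) = spin x (g 0) * spin x (g l)"
proof (induction l)
  case (Suc l)
  have "spin x (g 0) * spin x (g l) * (spin x (g l) * spin x (g (Suc l)))
      = spin x (g 0) * (spin x (g l) * spin x (g l)) * spin x (g (Suc l))"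
    by (simp only: mult_ac)
  with Suc show ?case by simp
qed simp

text \<open>Signs are indexed by position rather than by edge, so that the bound serves both
  arbitrary edge signs and the constant sign of MaxCut.\<close>

lemma ring_energy_bound:
  assumes k: "k \<ge> 2" and n: "n = (2 * R + 1) * k" "CARD('v::finite) = n"
    and ring: "ring_graph f E" and prep: "Z2_prepared E R (\<psi> :: 'v qstate)"
    and \<tau>: "\<And>i. i < n \<Longrightarrow> \<tau> i = -1 \<or> \<tau> i = (1::real)"
  shows "real k \<le> (\<Sum>x\<in>UNIV. (cmod (\<psi> $ x))\<^sup>2 *
           (\<Sum>i<n. 1 + \<tau> i * (spin x (f i) * spin x (f (Suc i mod n)))))"
proof -
  define l where "l = 2 * R + 1"
  let ?p = "\<lambda>x. (cmod (\<psi> $ x))\<^sup>2"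
  let ?t = "\<lambda>x i. \<tau> i * (spin x (f i) * spin x (f (Suc i mod n)))"
  have nl: "n = k * l" using n by (simp add: l_def mult.commute)
  have lt: "m * l + r < n" if "m < k" "r < l" for m r
  proof -
    have "m * l + r < Suc m * l" using that by simp
    also have "\<dots> \<le> n" unfolding nl using that by (intro mult_le_mono1) simp
    finally show ?thesis .
  qed
  define c where "c m = (\<Prod>r<l. \<tau> (m * l + r))" for m
  \<comment> \<open>The end vertex is reduced mod \<open>n\<close> because the last arc closes up at
    \<open>f 0\<close>.\<close>
  define Z where "Z x m = spin x (f (m * l)) * spin x (f ((m * l + l) mod n))" for x m
  have arc: "1 + c m * Z x m \<le> (\<Sum>r<l. 1 + ?t x (m * l + r))" if "m < k" for x m
  proof -
    \<comment> \<open>Only the index \<open>r = l\<close> can wrap around, so the reduction changes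
      no starting vertex of an edge in the arc.\<close>
    let ?g = "\<lambda>r. f ((m * l + r) mod n)"
    have "(\<Prod>r<l. ?t x (m * l + r)) = c m * (\<Prod>r<l. spin x (?g r) * spin x (?g (Suc r)))"
      unfolding c_def prod.distrib[symmetric] using lt[OF that] by (intro prod.cong) auto
    also have "\<dots> = c m * Z x m"
      using prod_spin_telescope[of x ?g l] lt[OF that, of 0] by (simp add: Z_def l_def)
    finally have "(\<Prod>r<l. ?t x (m * l + r)) = c m * Z x m" .
    moreover have "?t x (m * l + r) = -1 \<or> ?t x (m * l + r) = 1" if "r < l" for r
      using \<tau>[OF lt[OF \<open>m < k\<close> that]] spin_cases[of x "f (m * l + r)"]
        spin_cases[of x "f (Suc (m * l + r) mod n)"] by auto
    ultimately show ?thesis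
      using sum_signs_ge_prod[of "{..<l}" "\<lambda>r. ?t x (m * l + r)"] by (simp add: l_def)
  qed
  \<comment> \<open>Two arcs fit on the ring, so \<open>l + 2 * R = 2 * l - 1 < n\<close>: the ends
    of an arc are more than \<open>2 * R\<close> apart both ways around.\<close>
  have "2 * l \<le> n" unfolding nl using k by (rule mult_le_mono1)
  have mean: "(\<Sum>x\<in>UNIV. ?p x * Z x m) = 0" if "m < k" for m
  proof -
    have "graph_ball E (f (m * l)) R \<inter> graph_ball E (f ((m * l + l) mod n)) R = {}"
      using lt[OF that, of 0] \<open>2 * l \<le> n\<close>
      by (intro ring_balls_disjoint[OF ring n(2)]) (auto simp: l_def)
    from expect_ZZ_far[OF prep this] show ?thesis
      unfolding Z_at_eq_diag_op diag_op_mult expect_diag_op Z_def of_real_eq_0_iff .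
  qed
  have group: "(\<Sum>m<k. \<Sum>r<l. 1 + ?t x (m * l + r)) = (\<Sum>i<n. 1 + ?t x i)" for x
  proof -
    have "(\<Sum>r<l. 1 + ?t x (m * l + r)) = sum (\<lambda>i. 1 + ?t x i) {m * l..<m * l + l}" for m
      by (rule sum.reindex_bij_witness[of _ "\<lambda>i. i - m * l" "\<lambda>r. m * l + r"]) auto
    then show ?thesis
      unfolding nl by (simp only: sum.nat_group)
  qed
  \<comment> \<open>The end-to-end terms average to 0 and the weights sum to 1, leaving 1 per
    arc.\<close>
  have "(\<Sum>x\<in>UNIV. ?p x * (\<Sum>m<k. 1 + c m * Z x m))
      = (\<Sum>m<k. \<Sum>x\<in>UNIV. ?p x + c m * (?p x * Z x m))"
    by (subst sum.swap) (simp add: sum_distrib_left algebra_simps)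
  also have "\<dots> = (\<Sum>m<k. 1)"
    using Z2_prepared_is_state[OF prep]
    by (intro sum.cong refl)
      (simp add: sum.distrib sum_distrib_left[symmetric] mean is_state_iff)
  finally have "real k = (\<Sum>x\<in>UNIV. ?p x * (\<Sum>m<k. 1 + c m * Z x m))" by simp
  also have "\<dots> \<le> (\<Sum>x\<in>UNIV. ?p x * (\<Sum>m<k. \<Sum>r<l. 1 + ?t x (m * l + r)))"
    by (intro sum_mono mult_left_mono arc) auto
  finally show ?thesis by (simp only: group)
qed

section \<open>From ring positions to edges, and the final bounds\<close>

text \<open>Distinct positions giving the same edge would each be the successor of the other modulo
  \<open>n\<close>, forcing \<open>n\<close> to divide 2.\<close>

lemma ring_edges_inj:
  assumes "ring_graph (f :: nat \<Rightarrow> 'v::finite) E" and n: "CARD('v) = n" and "n \<ge> 3"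
  shows "inj_on (\<lambda>i. {f i, f (Suc i mod n)}) {..<n}"
proof (rule inj_onI)
  fix i j assume ij: "i \<in> {..<n}" "j \<in> {..<n}" "{f i, f (Suc i mod n)} = {f j, f (Suc j mod n)}"
  have inj: "a = b" if "f a = f b" "a < n" "b < n" for a b
    using assms that by (auto simp: ring_graph_def bij_betw_def inj_on_def)
  have "Suc i mod n < n" "Suc j mod n < n" using \<open>n \<ge> 3\<close> by auto
  with ij consider "i = j" | "i = Suc j mod n" "Suc i mod n = j"
    using inj[of i j] inj[of i "Suc j mod n"] inj[of "Suc i mod n" j] by (auto simp: doubleton_eq_iff)
  then show "i = j"
  proof cases
    case 2
    have suc: "Suc m mod n = (if Suc m = n then 0 else Suc m)" if "m < n" for m
      using that by (simp add: mod_Suc)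
    have "i < n" "j < n" using ij by auto
    with 2 \<open>n \<ge> 3\<close> show ?thesis
      unfolding suc[OF \<open>i < n\<close>] suc[OF \<open>j < n\<close>] by presburger
  qed
qed

text \<open>The functions \<open>e0\<close> and \<open>e1\<close> name the ends of each edge in
  either order. The order on complex numbers also demands equal imaginary parts, so both bounds
  assert that the expectations are real.\<close>

theorem proposition36:
  fixes R k n :: nat
    and f :: "nat \<Rightarrow> 'v::finite"
    and E :: "'v set set"
    and \<psi> :: "'v qstate"
  assumes "R \<ge> 1"
    and "k \<ge> 2" and "even k"
    and "n = (2 * R + 1) * k"
    and "CARD('v) = n"
    and "ring_graph f E"
    and "Z2_prepared E R \<psi>"
  shows "(\<forall>(\<sigma> :: 'v set \<Rightarrow> real) e0 e1.
            (\<forall>e\<in>E. \<sigma> e \<in> {-1, 1} \<and> e = {e0 e, e1 e}) \<longrightarrow>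
            expect \<psi> (\<Sum>e\<in>E. mat 1 + \<sigma> e *\<^sub>R (Z_at (e0 e) ** Z_at (e1 e)))
              \<ge> complex_of_real (real n / (2 * real R + 1))) \<and>
         expect \<psi> (H_MaxCut f)
           \<le> complex_of_real (real n - real n / (2 * (2 * real R + 1)))"
proof (intro conjI allI impI)
  note bound = ring_energy_bound[OF \<open>k \<ge> 2\<close> \<open>n = _\<close> \<open>CARD('v) = n\<close> \<open>ring_graph f E\<close> \<open>Z2_prepared E R \<psi>\<close>]
  let ?p = "\<lambda>x. (cmod (\<psi> $ x))\<^sup>2"
  let ?e = "\<lambda>i. {f i, f (Suc i mod n)}"
  have k: "real n / (2 * real R + 1) = real k"
    using \<open>n = _\<close> by (simp add: field_simps)
  \<comment> \<open>Gives \<open>n \<ge> 3\<close>, so that the sum over \<open>E\<close> can be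
    reindexed by positions.\<close>
  have "3 * 2 \<le> n"
    unfolding \<open>n = _\<close> using \<open>R \<ge> 1\<close> \<open>k \<ge> 2\<close> by (intro mult_le_mono) auto
  have E: "E = ?e ` {..<n}"
    using \<open>ring_graph f E\<close> \<open>CARD('v) = n\<close> by (auto simp: ring_graph_def)
  {
    fix \<sigma> :: "'v set \<Rightarrow> real" and e0 e1
    assume \<sigma>: "\<forall>e\<in>E. \<sigma> e \<in> {-1, 1} \<and> e = {e0 e, e1 e}"
    \<comment> \<open>Makes the term of an edge independent of how \<open>e0\<close> and
      \<open>e1\<close> order its ends.\<close>
    have spin_pair: "spin x (c :: 'v) * spin x d = spin x a * spin x b" if "{a, b} = {c, d}" for x a b c d
      using that by (auto simp: doubleton_eq_iff)
    have sign: "\<sigma> (?e i) = -1 \<or> \<sigma> (?e i) = 1" if "i < n" for i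
      using bspec[OF \<sigma>, THEN conjunct1, of "?e i"] that unfolding E by blast
    have "(\<Sum>e\<in>E. 1 + \<sigma> e * (spin x (e0 e) * spin x (e1 e)))
        = (\<Sum>i<n. 1 + \<sigma> (?e i) * (spin x (f i) * spin x (f (Suc i mod n))))" for x
    proof -
      have "spin x (e0 (?e i)) * spin x (e1 (?e i)) = spin x (f i) * spin x (f (Suc i mod n))"
        if "i < n" for i
      proof -
        have "?e i \<in> E" unfolding E using that by blast
        from bspec[OF \<sigma> this] have "?e i = {e0 (?e i), e1 (?e i)}" by (rule conjunct2)
        then show ?thesis by (rule spin_pair)
      qed
      then show ?thesis
        unfolding E using ring_edges_inj[OF \<open>ring_graph f E\<close> \<open>CARD('v) = n\<close>] \<open>3 * 2 \<le> n\<close>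
        by (subst sum.reindex) auto
    qed
    moreover have "real k \<le> (\<Sum>x\<in>UNIV. ?p x *
        (\<Sum>i<n. 1 + \<sigma> (?e i) * (spin x (f i) * spin x (f (Suc i mod n)))))"
      using sign by (rule bound)
    ultimately show "complex_of_real (real n / (2 * real R + 1))
        \<le> expect \<psi> (\<Sum>e\<in>E. mat 1 + \<sigma> e *\<^sub>R (Z_at (e0 e) ** Z_at (e1 e)))"
      by (simp only: k Z_at_eq_diag_op mat_1_eq_diag_op diag_op_mult diag_op_scaleR diag_op_add
          diag_op_sum expect_diag_op less_eq_complex_def Re_complex_of_real Im_complex_of_real)
  }
  let ?s = "\<lambda>x i. spin x (f i) * spin x (f (Suc i mod n))"
  \<comment> \<open>Each MaxCut term is 1 minus half of a term of the first bound with sign 1, so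
    the lower bound turns into an upper bound.\<close>
  have "(\<Sum>i<n. 1/2 * (1 - ?s x i)) = real n - 1/2 * (\<Sum>i<n. 1 + 1 * ?s x i)" for x
    by (simp add: sum.distrib sum_subtractf field_simps flip: sum_divide_distrib)
  then have "(\<Sum>x\<in>UNIV. ?p x * (\<Sum>i<n. 1/2 * (1 - ?s x i)))
      = (\<Sum>x\<in>UNIV. real n * ?p x - 1/2 * (?p x * (\<Sum>i<n. 1 + 1 * ?s x i)))"
    by (simp only: right_diff_distrib mult_ac)
  also have "\<dots> = real n - 1/2 * (\<Sum>x\<in>UNIV. ?p x * (\<Sum>i<n. 1 + 1 * ?s x i))"
    using Z2_prepared_is_state[OF \<open>Z2_prepared E R \<psi>\<close>]
    by (simp only: sum_subtractf sum_distrib_left[symmetric] is_state_iff)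
  also have "\<dots> \<le> real n - 1/2 * real k"
    using bound[of "\<lambda>_. 1"] by simp
  also have "\<dots> = real n - real n / (2 * (2 * real R + 1))"
    unfolding k[symmetric] by simp
  finally show "expect \<psi> (H_MaxCut f) \<le> complex_of_real (real n - real n / (2 * (2 * real R + 1)))"
    by (simp only: H_MaxCut_def \<open>CARD('v) = n\<close> Z_at_eq_diag_op mat_1_eq_diag_op diag_op_mult
        diag_op_scaleR diag_op_diff diag_op_sum expect_diag_op less_eq_complex_def
        Re_complex_of_real Im_complex_of_real)
qed

end
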